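(* Let $(G,\Gamma)$ be a discrete Hecke pair with reduction $(G_r,\Gamma_r)$ and Schlichting completion $(\overline{G},\overline{\Gamma})$. If $G$ (or $G_r$) has subexponential growth as a discrete group, then so does $\overline{G}$ in its locally compact topology.
   Context: A locally compact group $H$ with Haar measure $\mu$ has subexponential growth if $\limsup_{n\to\infty}\mu(V^n)^{1/n}=1$ for every compact neighbourhood $V$ of $e$. A Hecke pair $(G,\Gamma)$ is a group $G$ with a subgroup $\Gamma$ such that every double coset $\Gamma g\Gamma$ is a union of finitely many left (and right) cosets of $\Gamma$. Its reduction is $(G_r,\Gamma_r)=(G/R^\Gamma,\Gamma/R^\Gamma)$ with $R^\Gamma=\bigcap_{g\in G}g\Gamma g^{-1}$. Schlichting completion: $\overline{G}$ is the closure of the image of $G$ in the permutation group of the set $G/\Gamma$ (action by left multiplication, topology of pointwise convergence with $G/\Gamma$ discrete), and $\overline{\Gamma}$ is the closure of the image of $\Gamma$. Then $\overline{G}$ is a totally disconnected locally compact group, $\overline{\Gamma}$ is a compact open subgroup, and $G_r$ embeds as a dense subgroup of $\overline{G}$. *)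

theory Defs
  imports
    "HOL-Analysis.Analysis"
    "HOL-Algebra.Coset"
    "HOL-Algebra.Left_Coset"
    "HOL-Algebra.Bij"
begin

definition locally_compact_group :: "('a, 'b) monoid_scheme \<Rightarrow> 'a topology \<Rightarrow> bool" where
  "locally_compact_group H T \<longleftrightarrow>
     group H \<and> topspace T = carrier H \<and>
     continuous_map (prod_topology T T) T (\<lambda>(x, y). x \<otimes>\<^bsub>H\<^esub> y) \<and>
     continuous_map T T (\<lambda>x. inv\<^bsub>H\<^esub> x) \<and>
     Hausdorff_space T \<and> locally_compact_space T"

text \<open>A left Haar measure: a nonzero left-invariant Radon measure on the Borel sets
  (finite on compact sets, outer regular on Borel sets, inner regular on open sets).\<close>

definition haar_measure :: "('a, 'b) monoid_scheme \<Rightarrow> 'a topology \<Rightarrow> 'a measure \<Rightarrow> bool" where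
  "haar_measure H T \<mu> \<longleftrightarrow>
     space \<mu> = topspace T \<and>
     sets \<mu> = sigma_sets (topspace T) {U. openin T U} \<and>
     emeasure \<mu> (space \<mu>) \<noteq> 0 \<and>
     (\<forall>K. compactin T K \<longrightarrow> emeasure \<mu> K < \<infinity>) \<and>
     (\<forall>g\<in>carrier H. \<forall>A\<in>sets \<mu>. emeasure \<mu> (g <#\<^bsub>H\<^esub> A) = emeasure \<mu> A) \<and>
     (\<forall>A\<in>sets \<mu>. emeasure \<mu> A = (INF U\<in>{U. openin T U \<and> A \<subseteq> U}. emeasure \<mu> U)) \<and>
     (\<forall>U. openin T U \<longrightarrow>
        emeasure \<mu> U = (SUP K\<in>{K. compactin T K \<and> K \<subseteq> U}. emeasure \<mu> K))"

definition compact_nhd_one :: "('a, 'b) monoid_scheme \<Rightarrow> 'a topology \<Rightarrow> 'a set \<Rightarrow> bool" where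
  "compact_nhd_one H T V \<longleftrightarrow>
     compactin T V \<and> (\<exists>U. openin T U \<and> \<one>\<^bsub>H\<^esub> \<in> U \<and> U \<subseteq> V)"

primrec set_power :: "('a, 'b) monoid_scheme \<Rightarrow> 'a set \<Rightarrow> nat \<Rightarrow> 'a set" where
  "set_power H V 0 = {\<one>\<^bsub>H\<^esub>}"
| "set_power H V (Suc n) = set_power H V n <#>\<^bsub>H\<^esub> V"

text \<open>Haar measures exist on every locally compact group and are unique up to a positive
  scalar, which does not affect the growth rate; hence the quantification over all of them.
  Powers of a compact set are compact, so \<^const>\<open>measure\<close> takes the true, finite values.\<close>

definition subexponential_growth :: "('a, 'b) monoid_scheme \<Rightarrow> 'a topology \<Rightarrow> bool" where
  "subexponential_growth H T \<longleftrightarrow>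
     locally_compact_group H T \<and>
     (\<forall>\<mu>. haar_measure H T \<mu> \<longrightarrow>
        (\<forall>V. compact_nhd_one H T V \<longrightarrow>
           limsup (\<lambda>n. ereal (root n (measure \<mu> (set_power H V n)))) = 1))"

definition hecke_pair :: "('a, 'b) monoid_scheme \<Rightarrow> 'a set \<Rightarrow> bool" where
  "hecke_pair G \<Gamma> \<longleftrightarrow>
     group G \<and> subgroup \<Gamma> G \<and>
     (\<forall>g\<in>carrier G.
        (\<exists>F. finite F \<and> F \<subseteq> carrier G \<and>
             (\<Gamma> #>\<^bsub>G\<^esub> g) <#>\<^bsub>G\<^esub> \<Gamma> = (\<Union>x\<in>F. x <#\<^bsub>G\<^esub> \<Gamma>)) \<and>
        (\<exists>F. finite F \<and> F \<subseteq> carrier G \<and>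
             (\<Gamma> #>\<^bsub>G\<^esub> g) <#>\<^bsub>G\<^esub> \<Gamma> = (\<Union>x\<in>F. \<Gamma> #>\<^bsub>G\<^esub> x)))"

definition hecke_core :: "('a, 'b) monoid_scheme \<Rightarrow> 'a set \<Rightarrow> 'a set" where
  "hecke_core G \<Gamma> = (\<Inter>g\<in>carrier G. (g <#\<^bsub>G\<^esub> \<Gamma>) #>\<^bsub>G\<^esub> inv\<^bsub>G\<^esub> g)"

definition reduced_group :: "('a, 'b) monoid_scheme \<Rightarrow> 'a set \<Rightarrow> 'a set monoid" where
  "reduced_group G \<Gamma> = G Mod hecke_core G \<Gamma>"

definition coset_action ::
    "('a, 'b) monoid_scheme \<Rightarrow> 'a set \<Rightarrow> 'a \<Rightarrow> 'a set \<Rightarrow> 'a set" where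
  "coset_action G \<Gamma> g = (\<lambda>X \<in> lcosets\<^bsub>G\<^esub> \<Gamma>. g <#\<^bsub>G\<^esub> X)"

text \<open>Pointwise convergence on the permutations of a discrete set. Elements of \<^term>\<open>Bij S\<close>
  are extensional, hence points of the product space of functions from \<^term>\<open>S\<close> to itself.\<close>

definition permutation_topology :: "'a set \<Rightarrow> ('a \<Rightarrow> 'a) topology" where
  "permutation_topology S =
     subtopology (product_topology (\<lambda>_. discrete_topology S) S) (Bij S)"

definition schlichting_carrier :: "('a, 'b) monoid_scheme \<Rightarrow> 'a set \<Rightarrow> ('a set \<Rightarrow> 'a set) set" where
  "schlichting_carrier G \<Gamma> =
     permutation_topology (lcosets\<^bsub>G\<^esub> \<Gamma>) closure_of (coset_action G \<Gamma> ` carrier G)"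

definition schlichting_group ::
    "('a, 'b) monoid_scheme \<Rightarrow> 'a set \<Rightarrow> ('a set \<Rightarrow> 'a set) monoid" where
  "schlichting_group G \<Gamma> =
     (BijGroup (lcosets\<^bsub>G\<^esub> \<Gamma>)) \<lparr>carrier := schlichting_carrier G \<Gamma>\<rparr>"

definition schlichting_topology ::
    "('a, 'b) monoid_scheme \<Rightarrow> 'a set \<Rightarrow> ('a set \<Rightarrow> 'a set) topology" where
  "schlichting_topology G \<Gamma> =
     subtopology (permutation_topology (lcosets\<^bsub>G\<^esub> \<Gamma>)) (schlichting_carrier G \<Gamma>)"

end

theory Submission
  imports Defs
begin

text \<open>The group \<open>G\<close> (or \<open>G\<^sub>r\<close>) has dense image in its Schlichting completion \<open>L\<close>.
  If \<open>V\<close> is a compact neighbourhood of \<open>1\<close> in \<open>L\<close>, then \<open>V V\<close> is covered by finitely many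
  translates of \<open>V\<close> by elements of the image, so \<open>V V \<subseteq> h(E) V\<close> for a finite
  set \<open>E\<close> in the discrete group. By induction the power \<open>n + 1\<close> of \<open>V\<close> lies in \<open>h(E') V\<close>, where
  \<open>E'\<close> is the power \<open>n\<close> of \<open>E\<close>. Hence the Haar measure of the powers of \<open>V\<close> grows at most as
  fast as the number of elements of the powers of \<open>E\<close>; it is bounded below by the
  positive measure of \<open>V\<close>. The remaining point is that \<open>L\<close> is locally compact: the
  closure of \<open>\<Gamma>\<close> is compact because the Hecke condition makes the \<open>\<Gamma>\<close>-orbits on \<open>G/\<Gamma>\<close> finite.\<close>

section \<open>Topological groups\<close>

text \<open>Kept separate from \<open>locally_compact_group\<close> so that it also covers the full
  permutation group \<open>BijGroup S\<close>, which need not be locally compact.\<close>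

locale topological_group = group G for G :: "('a, 'b) monoid_scheme" (structure) +
  fixes T :: "'a topology"
  assumes topspace_eq: "topspace T = carrier G"
    and continuous_mult: "continuous_map (prod_topology T T) T (\<lambda>(x, y). x \<otimes> y)"
    and continuous_inv: "continuous_map T T (\<lambda>x. inv x)"

lemma locally_compact_group_iff:
  "locally_compact_group G T \<longleftrightarrow>
     topological_group G T \<and> Hausdorff_space T \<and> locally_compact_space T"
  by (auto simp: locally_compact_group_def topological_group_def topological_group_axioms_def)

context topological_group
begin

section \<open>Translates, products and powers of open and compact sets\<close>

lemma continuous_mult_left:
  assumes "g \<in> carrier G"
  shows "continuous_map T T (\<lambda>x. g \<otimes> x)"
proof -
  have "continuous_map T (prod_topology T T) (\<lambda>x. (g, x))"
    using assms by (intro continuous_map_pairedI) (auto simp: topspace_eq)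
  from continuous_map_compose[OF this continuous_mult] show ?thesis
    by (simp add: o_def)
qed

lemma l_coset_eq_image: "g <# A = (\<lambda>x. g \<otimes> x) ` A"
  by (auto simp: l_coset_def)

lemma openin_l_coset:
  assumes "openin T U" "g \<in> carrier G"
  shows "openin T (g <# U)"
proof -
  have U: "U \<subseteq> carrier G"
    using assms(1) openin_subset topspace_eq by blast
  \<comment> \<open>Continuity controls preimages, so the translate by \<open>g\<close> is rewritten
    as the preimage of \<open>U\<close> under translation by \<open>inv g\<close>.\<close>
  have "g <# U = {x \<in> topspace T. inv g \<otimes> x \<in> U}" (is "?L = ?R")
  proof
    show "?L \<subseteq> ?R"
      using U assms(2) by (auto simp: l_coset_def topspace_eq m_assoc[symmetric] subset_iff)
    show "?R \<subseteq> ?L"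
    proof
      fix x assume x: "x \<in> ?R"
      then have "x = g \<otimes> (inv g \<otimes> x)"
        using assms(2) by (simp add: topspace_eq m_assoc[symmetric])
      with x show "x \<in> ?L" by (auto simp: l_coset_def)
    qed
  qed
  with openin_continuous_map_preimage[OF continuous_mult_left[of "inv g"] assms(1)] assms(2)
  show ?thesis by simp
qed

lemma compactin_l_coset:
  assumes "compactin T K" "g \<in> carrier G"
  shows "compactin T (g <# K)"
  using image_compactin[OF assms(1) continuous_mult_left[OF assms(2)]] by (simp add: l_coset_eq_image)

lemma compactin_set_mult:
  assumes "compactin T A" "compactin T B"
  shows "compactin T (A <#> B)"
proof -
  have "A <#> B = (\<lambda>(x, y). x \<otimes> y) ` (A \<times> B)"
    by (auto simp: set_mult_def)
  moreover have "compactin (prod_topology T T) (A \<times> B)"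
    using assms by (simp add: compactin_Times)
  ultimately show ?thesis
    using image_compactin continuous_mult by metis
qed

lemma compactin_set_power:
  assumes "compactin T V"
  shows "compactin T (set_power G V n)"
  by (induction n) (auto simp: topspace_eq intro: compactin_set_mult assms)

text \<open>For each \<open>x\<close>, the set of all \<open>d\<close> with
  \<open>inv d \<otimes> x \<in> U\<close> is open and contains \<open>x\<close>, so it meets the
  dense set \<open>D\<close>. Hence the translates of \<open>U\<close> by elements of
  \<open>D\<close> cover the group, and compactness of \<open>K\<close> selects finitely many of
  them.\<close>

lemma compactin_subset_finite_set_mult:
  assumes "compactin T K" "openin T U" "\<one> \<in> U"
    and D: "D \<subseteq> carrier G" "T closure_of D = carrier G"
  obtains F where "finite F" "F \<subseteq> D" "K \<subseteq> F <#> U"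
proof -
  have "K \<subseteq> \<Union> ((\<lambda>d. d <# U) ` D)"
  proof
    fix x assume "x \<in> K"
    then have x: "x \<in> carrier G"
      using compactin_subset_topspace[OF assms(1)] by (auto simp: topspace_eq)
    have "continuous_map T (prod_topology T T) (\<lambda>d. (inv d, x))"
      using x by (intro continuous_map_pairedI continuous_inv) (auto simp: topspace_eq)
    from continuous_map_compose[OF this continuous_mult]
    have "continuous_map T T (\<lambda>d. inv d \<otimes> x)" by (simp add: o_def)
    from openin_continuous_map_preimage[OF this assms(2)]
    have "openin T {d \<in> topspace T. inv d \<otimes> x \<in> U}" .
    moreover have "x \<in> {d \<in> topspace T. inv d \<otimes> x \<in> U}"
      using x assms(3) by (simp add: topspace_eq)
    moreover have "\<forall>V. x \<in> V \<and> openin T V \<longrightarrow> (\<exists>d. d \<in> D \<and> d \<in> V)"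
      using D(2) x in_closure_of[of x T D] by simp
    ultimately have "\<exists>d. d \<in> D \<and> d \<in> {d \<in> topspace T. inv d \<otimes> x \<in> U}"
      by meson
    then obtain d where d: "d \<in> D" "inv d \<otimes> x \<in> U" by auto
    moreover have "x = d \<otimes> (inv d \<otimes> x)"
      using d(1) D(1) x by (auto simp: m_assoc[symmetric] subset_iff)
    ultimately show "x \<in> \<Union> ((\<lambda>d. d <# U) ` D)"
      by (auto simp: l_coset_def)
  qed
  moreover have "openin T W" if "W \<in> (\<lambda>d. d <# U) ` D" for W
    using that D(1) openin_l_coset[OF assms(2)] by auto
  ultimately have "\<exists>\<F>. finite \<F> \<and> \<F> \<subseteq> (\<lambda>d. d <# U) ` D \<and> K \<subseteq> \<Union>\<F>"
    by (intro compactinD[OF assms(1)])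
  then obtain \<F> where "finite \<F>" "\<F> \<subseteq> (\<lambda>d. d <# U) ` D" "K \<subseteq> \<Union>\<F>"
    by auto
  then obtain F where "finite F" "F \<subseteq> D" "\<F> = (\<lambda>d. d <# U) ` F"
    using finite_subset_image by metis
  with \<open>K \<subseteq> \<Union>\<F>\<close> show thesis
    by (intro that) (auto simp: set_mult_def l_coset_def)
qed

section \<open>Closures of subgroups, subspace topologies and homogeneity\<close>

lemma subgroup_closure_of:
  assumes "subgroup A G"
  shows "subgroup (T closure_of A) G"
proof -
  interpret A: subgroup A G by fact
  have mult: "x \<otimes> y \<in> T closure_of A" if "x \<in> T closure_of A" "y \<in> T closure_of A" for x y
  proof -
    \<comment> \<open>The closure of \<open>A \<times> A\<close> is the product of the closures, so
      continuity of the multiplication on pairs gives closedness under products.\<close>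
    have "(\<lambda>(x, y). x \<otimes> y) ` (A \<times> A) \<subseteq> A" by auto
    then have "(\<lambda>(x, y). x \<otimes> y) ` (prod_topology T T closure_of (A \<times> A)) \<subseteq> T closure_of A"
      using continuous_map_image_closure_subset[OF continuous_mult, of "A \<times> A"] closure_of_mono
      by fastforce
    then show ?thesis using that by (auto simp: closure_of_Times)
  qed
  have "(\<lambda>x. inv x) ` A \<subseteq> A" by auto
  then have "(\<lambda>x. inv x) ` (T closure_of A) \<subseteq> T closure_of A"
    using continuous_map_image_closure_subset[OF continuous_inv, of A] closure_of_mono
    by fastforce
  moreover have "A \<subseteq> T closure_of A"
    by (simp add: closure_of_subset topspace_eq A.subset)
  ultimately show ?thesis
    using closure_of_subset_topspace[of T A] mult A.one_closed
    by (intro subgroupI) (fastforce simp: topspace_eq)+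
qed

lemma topological_group_subgroup:
  assumes "subgroup A G"
  shows "topological_group (G\<lparr>carrier := A\<rparr>) (subtopology T A)"
proof -
  interpret A: subgroup A G by fact
  interpret S: group "G\<lparr>carrier := A\<rparr>" by (rule subgroup_imp_group) fact
  show ?thesis
  proof
    show "topspace (subtopology T A) = carrier (G\<lparr>carrier := A\<rparr>)"
      using A.subset by (auto simp: topspace_eq)
    have "prod_topology (subtopology T A) (subtopology T A) = subtopology (prod_topology T T) (A \<times> A)"
      by (simp add: subtopology_Times)
    then show "continuous_map (prod_topology (subtopology T A) (subtopology T A)) (subtopology T A)
        (\<lambda>(x, y). x \<otimes>\<^bsub>G\<lparr>carrier := A\<rparr>\<^esub> y)"
      using continuous_mult
      by (auto simp: continuous_map_in_subtopology intro: continuous_map_from_subtopology)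
    have "continuous_map (subtopology T A) (subtopology T A) (\<lambda>x. inv x)"
      using continuous_inv
      by (auto simp: continuous_map_in_subtopology intro: continuous_map_from_subtopology)
    then show "continuous_map (subtopology T A) (subtopology T A) (\<lambda>x. inv\<^bsub>G\<lparr>carrier := A\<rparr>\<^esub> x)"
      by (rule continuous_map_eq) (use assms in auto)
  qed
qed

text \<open>Homogeneity: left translation carries a compact neighbourhood of the identity to one of
  any given point.\<close>

lemma locally_compact_space_if_compact_nhd:
  assumes "openin T U" "compactin T K" "\<one> \<in> U" "U \<subseteq> K"
  shows "locally_compact_space T"
  unfolding locally_compact_space_def
proof (intro ballI exI conjI)
  fix x assume "x \<in> topspace T"
  then have x: "x \<in> carrier G" by (simp add: topspace_eq)
  show "openin T (x <# U)" "compactin T (x <# K)"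
    using assms x by (auto intro: openin_l_coset compactin_l_coset)
  show "x \<in> x <# U"
    using assms(3) x by (force simp: l_coset_def)
  show "x <# U \<subseteq> x <# K"
    using assms(4) by (auto simp: l_coset_def)
qed

end

section \<open>Haar measure\<close>

locale haar_group = topological_group +
  fixes \<mu>
  assumes Hausdorff: "Hausdorff_space T" and haar: "haar_measure G T \<mu>"
begin

lemma
  shows space_haar: "space \<mu> = topspace T"
    and sets_haar: "sets \<mu> = sigma_sets (topspace T) {U. openin T U}"
    and emeasure_space_haar: "emeasure \<mu> (space \<mu>) \<noteq> 0"
    and emeasure_compactin_finite: "compactin T K \<Longrightarrow> emeasure \<mu> K < \<infinity>"
    and emeasure_l_coset: "g \<in> carrier G \<Longrightarrow> A \<in> sets \<mu> \<Longrightarrow> emeasure \<mu> (g <# A) = emeasure \<mu> A"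
    and emeasure_inner_regular:
      "openin T U \<Longrightarrow> emeasure \<mu> U = (SUP K\<in>{K. compactin T K \<and> K \<subseteq> U}. emeasure \<mu> K)"
  using haar unfolding haar_measure_def by blast+

lemma sets_openin: "openin T U \<Longrightarrow> U \<in> sets \<mu>"
  by (auto simp: sets_haar)

lemma sets_compactin:
  assumes "compactin T K"
  shows "K \<in> sets \<mu>"
proof -
  have "closedin T K" using compactin_imp_closedin[OF Hausdorff assms] .
  then have "topspace T - (topspace T - K) = K" "openin T (topspace T - K)"
    by (auto simp: closedin_def)
  then show ?thesis
    using sets.compl_sets[OF sets_openin, of "topspace T - K"]
    by (simp add: space_haar)
qed

text \<open>Subadditivity over the translates together with left invariance. Measurability of the
  translates is assumed here; it is supplied later by the fact that translates of open sets are open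
  and translates of compact sets are compact.\<close>

lemma emeasure_set_mult_le:
  assumes "finite F" "F \<subseteq> carrier G" "A \<in> sets \<mu>" "\<And>g. g \<in> F \<Longrightarrow> g <# A \<in> sets \<mu>"
  shows "emeasure \<mu> (F <#> A) \<le> of_nat (card F) * emeasure \<mu> A"
proof -
  have "emeasure \<mu> (F <#> A) = emeasure \<mu> (\<Union>g\<in>F. g <# A)"
    by (rule arg_cong[where f = "emeasure \<mu>"]) (auto simp: set_mult_def l_coset_def)
  also have "\<dots> \<le> (\<Sum>g\<in>F. emeasure \<mu> (g <# A))"
    using assms by (intro emeasure_subadditive_finite) auto
  also have "\<dots> = (\<Sum>g\<in>F. emeasure \<mu> A)"
    using assms by (intro sum.cong) (auto simp: emeasure_l_coset)
  finally show ?thesis by simp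
qed

text \<open>A compact set is covered by finitely many translates of \<open>U\<close>. If
  \<open>U\<close> were null, every compact set would be null, and inner regularity of the open set
  \<open>topspace T\<close> would make the whole measure zero.\<close>

lemma emeasure_open_nhd_pos:
  assumes "openin T U" "\<one> \<in> U"
  shows "emeasure \<mu> U \<noteq> 0"
proof
  assume zero: "emeasure \<mu> U = 0"
  have "emeasure \<mu> K = 0" if K: "compactin T K" for K
  proof -
    have "T closure_of carrier G = carrier G"
      using closure_of_topspace[of T] by (simp add: topspace_eq)
    then obtain F where F: "finite F" "F \<subseteq> carrier G" "K \<subseteq> F <#> U"
      by (rule compactin_subset_finite_set_mult[OF K assms subset_refl])
    have "openin T (F <#> U)"
    proof -
      have "F <#> U = (\<Union>g\<in>F. g <# U)" by (auto simp: set_mult_def l_coset_def)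
      then show ?thesis using F(2) assms(1) by (auto intro!: openin_Union openin_l_coset)
    qed
    then have "emeasure \<mu> K \<le> emeasure \<mu> (F <#> U)"
      using F(3) by (intro emeasure_mono sets_openin)
    also have "\<dots> \<le> of_nat (card F) * emeasure \<mu> U"
      using F assms(1) by (intro emeasure_set_mult_le) (auto intro: sets_openin openin_l_coset)
    finally show ?thesis using zero by simp
  qed
  then have "(SUP K\<in>{K. compactin T K \<and> K \<subseteq> topspace T}. emeasure \<mu> K) \<le> 0"
    by (intro SUP_least) auto
  then have "emeasure \<mu> (topspace T) = 0"
    using emeasure_inner_regular[OF openin_topspace] by simp
  then show False using emeasure_space_haar by (simp add: space_haar)
qed

end

text \<open>Subexponential growth speaks of every Haar measure. Specialised to the counting measure,
  the hypothesis on a discrete group becomes a statement about cardinalities of powers of finite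
  sets.\<close>

lemma haar_measure_count_space:
  assumes "group G"
  shows "haar_measure G (discrete_topology (carrier G)) (count_space (carrier G))"
proof -
  interpret group G by fact
  let ?\<mu> = "count_space (carrier G)"
  have inv: "emeasure ?\<mu> (g <#\<^bsub>G\<^esub> A) = emeasure ?\<mu> A" if "g \<in> carrier G" "A \<subseteq> carrier G" for g A
  proof -
    have "g <#\<^bsub>G\<^esub> A = (\<lambda>x. g \<otimes>\<^bsub>G\<^esub> x) ` A" by (auto simp: l_coset_def)
    moreover have inj: "inj_on (\<lambda>x. g \<otimes>\<^bsub>G\<^esub> x) A"
      using that by (auto simp: inj_on_def subset_iff)
    moreover have "(\<lambda>x. g \<otimes>\<^bsub>G\<^esub> x) ` A \<subseteq> carrier G" using that by auto
    ultimately show ?thesis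
      using that by (simp add: emeasure_count_space finite_image_iff card_image)
  qed
  have outer: "emeasure ?\<mu> A = (INF U\<in>{U. U \<subseteq> carrier G \<and> A \<subseteq> U}. emeasure ?\<mu> U)"
    if "A \<subseteq> carrier G" for A
  proof (rule antisym)
    show "emeasure ?\<mu> A \<le> (INF U\<in>{U. U \<subseteq> carrier G \<and> A \<subseteq> U}. emeasure ?\<mu> U)"
      by (intro INF_greatest emeasure_mono) auto
    show "(INF U\<in>{U. U \<subseteq> carrier G \<and> A \<subseteq> U}. emeasure ?\<mu> U) \<le> emeasure ?\<mu> A"
      using that by (intro INF_lower) simp
  qed
  have inner: "emeasure ?\<mu> U = (SUP K\<in>{K. (K \<subseteq> carrier G \<and> finite K) \<and> K \<subseteq> U}. emeasure ?\<mu> K)"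
    if U: "U \<subseteq> carrier G" for U
  proof (rule antisym)
    show "emeasure ?\<mu> U \<le> (SUP K\<in>{K. (K \<subseteq> carrier G \<and> finite K) \<and> K \<subseteq> U}. emeasure ?\<mu> K)"
      (is "_ \<le> ?s")
    proof (cases "finite U")
      case True
      then show ?thesis using U by (intro SUP_upper) auto
    next
      case False
      \<comment> \<open>An infinite set has finite subsets of every cardinality, so the supremum
        exceeds every natural number and is infinite.\<close>
      have "of_nat n \<le> ?s" for n
      proof -
        obtain K where K: "K \<subseteq> U" "finite K" "card K = n"
          using infinite_arbitrarily_large[OF False] by metis
        then have "of_nat n = emeasure ?\<mu> K" using U by (simp add: emeasure_count_space)
        also have "\<dots> \<le> ?s" using K U by (intro SUP_upper) auto
        finally show ?thesis .
      qed
      then have "?s = \<infinity>"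
        using SUP_least[of UNIV of_nat ?s] by (simp add: ennreal_SUP_of_nat_eq_top top_unique)
      then show ?thesis by (metis infinity_ennreal_def top_greatest)
    qed
    show "?s \<le> emeasure ?\<mu> U" using U by (intro SUP_least emeasure_mono) auto
  qed
  have nonzero: "emeasure ?\<mu> (carrier G) \<noteq> 0" using one_closed by (auto simp: emeasure_count_space_eq_0)
  have sets: "sigma_sets (carrier G) {U. U \<subseteq> carrier G} = Pow (carrier G)"
  proof
    show "sigma_sets (carrier G) {U. U \<subseteq> carrier G} \<subseteq> Pow (carrier G)"
      by (auto dest: sigma_sets_into_sp[rotated])
  qed (auto intro!: sigma_sets.Basic)
  have "emeasure ?\<mu> K < \<infinity>" if "K \<subseteq> carrier G" "finite K" for K
    using that by (simp add: emeasure_count_space of_nat_less_top)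
  then show ?thesis
    unfolding haar_measure_def space_count_space sets_count_space topspace_discrete_topology
      openin_discrete_topology compactin_discrete_topology sets
    by (intro conjI ballI allI impI nonzero inner outer inv) (auto simp only: Pow_iff)
qed

section \<open>Transfer of subexponential growth\<close>

lemma (in group) set_power_closed:
  assumes "V \<subseteq> carrier G"
  shows "set_power G V n \<subseteq> carrier G"
  using assms by (induction n) (auto simp: set_mult_closed)

lemma (in group) finite_set_power:
  assumes "finite V"
  shows "finite (set_power G V n)"
proof (induction n)
  case (Suc n)
  have "set_power G V n <#> V = (\<lambda>(x, y). x \<otimes> y) ` (set_power G V n \<times> V)"
    by (auto simp: set_mult_def)
  with Suc assms show ?case by simp
qed simp

lemma (in group) set_power_Suc_mono:
  assumes "V \<subseteq> carrier G" "\<one> \<in> V"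
  shows "set_power G V n \<subseteq> set_power G V (Suc n)"
proof
  fix x assume x: "x \<in> set_power G V n"
  then have "x \<otimes> \<one> = x" using set_power_closed[OF assms(1), of n] by auto
  with x assms(2) show "x \<in> set_power G V (Suc n)" by (force simp: set_mult_def)
qed

lemma (in group) subset_set_power:
  assumes "V \<subseteq> carrier G" "\<one> \<in> V" "n > 0"
  shows "V \<subseteq> set_power G V n"
  using assms(3)
proof (induction n)
  case (Suc n)
  show ?case
  proof (cases "n = 0")
    case True
    then show ?thesis using assms(1) by (force simp: set_mult_def)
  next
    case False
    with Suc set_power_Suc_mono[OF assms(1,2)] show ?thesis by blast
  qed
qed simp

text \<open>One factor \<open>V\<close> always stays at the right end. A further factor turns it
  into \<open>V V\<close>, which is replaced by \<open>h(E) V\<close>; the homomorphism then absorbs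
  \<open>h(E)\<close> into the image of the next power of \<open>E\<close>.\<close>

lemma (in group_hom) set_power_Suc_subset:
  assumes E: "E \<subseteq> carrier G" and V: "V \<subseteq> carrier H" and VV: "V <#>\<^bsub>H\<^esub> V \<subseteq> h ` E <#>\<^bsub>H\<^esub> V"
  shows "set_power H V (Suc n) \<subseteq> h ` set_power G E n <#>\<^bsub>H\<^esub> V"
proof (induction n)
  case 0
  show ?case using V by (auto simp: set_mult_def)
next
  case (Suc n)
  have P: "set_power G E n \<subseteq> carrier G" by (rule G.set_power_closed[OF E])
  then have hP: "h ` set_power G E n \<subseteq> carrier H" by auto
  have hE: "h ` E \<subseteq> carrier H" using E by auto
  have "set_power H V (Suc (Suc n)) \<subseteq> (h ` set_power G E n <#>\<^bsub>H\<^esub> V) <#>\<^bsub>H\<^esub> V"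
    using mono_set_mult[OF Suc subset_refl] by simp
  also have "\<dots> = h ` set_power G E n <#>\<^bsub>H\<^esub> (V <#>\<^bsub>H\<^esub> V)"
    using H.set_mult_assoc[OF hP V V] by simp
  also have "\<dots> \<subseteq> h ` set_power G E n <#>\<^bsub>H\<^esub> (h ` E <#>\<^bsub>H\<^esub> V)"
    by (rule mono_set_mult[OF subset_refl VV])
  also have "\<dots> = (h ` set_power G E n <#>\<^bsub>H\<^esub> h ` E) <#>\<^bsub>H\<^esub> V"
    using H.set_mult_assoc[OF hP hE V] by simp
  also have "h ` set_power G E n <#>\<^bsub>H\<^esub> h ` E = h ` set_power G E (Suc n)"
  proof -
    have "h (x \<otimes>\<^bsub>G\<^esub> y) = h x \<otimes>\<^bsub>H\<^esub> h y" if "x \<in> set_power G E n" "y \<in> E" for x y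
      using subsetD[OF P that(1)] subsetD[OF E that(2)] by (rule hom_mult)
    then show ?thesis unfolding set_power.simps set_mult_def by (simp add: image_UN)
  qed
  finally show ?case .
qed

text \<open>Stated for an arbitrary homomorphism with dense image, so that it applies both to
  \<open>G\<close> and to the reduced group.\<close>

lemma subexponential_growth_dense_image:
  assumes lc: "locally_compact_group L T"
    and "group H"
    and H: "subexponential_growth H (discrete_topology (carrier H))"
    and h: "h \<in> hom H L"
    and dense: "T closure_of (h ` carrier H) = carrier L"
  shows "subexponential_growth L T"
  unfolding subexponential_growth_def
proof (intro conjI allI impI lc)
  fix \<mu> V
  assume \<mu>: "haar_measure L T \<mu>" and V: "compact_nhd_one L T V"
  interpret H: group H by fact
  interpret L: haar_group L T \<mu>
    using lc \<mu> by (simp add: haar_group_def haar_group_axioms_def locally_compact_group_iff)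
  interpret group_hom H L h
    by (simp add: group_hom_def group_hom_axioms_def h H.is_group L.is_group)
  obtain U where K: "compactin T V" and U: "openin T U" "\<one>\<^bsub>L\<^esub> \<in> U" "U \<subseteq> V"
    using V unfolding compact_nhd_one_def by blast
  have Vc: "V \<subseteq> carrier L" using compactin_subset_topspace[OF K] by (simp add: L.topspace_eq)
  have V1: "\<one>\<^bsub>L\<^esub> \<in> V" using U by blast
  \<comment> \<open>The cover uses translates of the open set \<open>U\<close>, since
    \<open>V\<close> itself need not be open; enlarging \<open>U\<close> to \<open>V\<close> comes
    afterwards.\<close>
  obtain F where F: "finite F" "F \<subseteq> h ` carrier H" "V <#>\<^bsub>L\<^esub> V \<subseteq> F <#>\<^bsub>L\<^esub> U"
    by (rule L.compactin_subset_finite_set_mult[OF L.compactin_set_mult[OF K K] U(1,2) _ dense])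
      auto
  obtain E0 where E0: "E0 \<subseteq> carrier H" "finite E0" "F = h ` E0"
    using finite_subset_image[OF F(1,2)] by auto
  \<comment> \<open>The identity is added so that \<open>E\<close> is a neighbourhood of it in the
    discrete topology and the powers of \<open>E\<close> increase.\<close>
  define E where "E = insert \<one>\<^bsub>H\<^esub> E0"
  have E: "finite E" "E \<subseteq> carrier H" "\<one>\<^bsub>H\<^esub> \<in> E" using E0 by (auto simp: E_def)
  have "F <#>\<^bsub>L\<^esub> U \<subseteq> h ` E <#>\<^bsub>L\<^esub> V"
    using U(3) E0(3) by (intro mono_set_mult) (auto simp: E_def)
  with F(3) have VV: "V <#>\<^bsub>L\<^esub> V \<subseteq> h ` E <#>\<^bsub>L\<^esub> V" by simp
  \<comment> \<open>The aim is the squeeze \<open>m \<le> a n \<le> m * c n\<close> for positive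
    \<open>n\<close>.\<close>
  define m where "m = measure \<mu> V"
  define a where "a n = measure \<mu> (set_power L V n)" for n
  define c where "c n = real (card (set_power H E n))" for n
  have fin: "emeasure \<mu> A \<noteq> \<infinity>" if "compactin T A" for A
    using L.emeasure_compactin_finite[OF that] by simp
  \<comment> \<open>Finiteness matters, because \<open>measure\<close> assigns the value 0 to sets
    of infinite measure.\<close>
  have meas_mono: "measure \<mu> A \<le> measure \<mu> B" if "A \<subseteq> B" "compactin T A" "compactin T B" for A B
    using that fin[of A] fin[of B] L.sets_compactin[of B] L.sets_compactin[of A]
    by (intro measure_mono_fmeasurable) (auto simp: fmeasurable_def less_top)
  have "emeasure \<mu> U \<le> emeasure \<mu> V"
    using U L.sets_compactin[OF K] by (intro emeasure_mono)
  then have "emeasure \<mu> V \<noteq> 0" using L.emeasure_open_nhd_pos[OF U(1,2)] by auto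
  then have m: "m > 0"
    using fin[OF K] unfolding m_def measure_def
    by (simp add: enn2real_positive_iff less_top zero_less_iff_neq_zero)
  \<comment> \<open>The power \<open>Suc n\<close> of \<open>V\<close> lies in at most
    \<open>c n\<close> translates of \<open>V\<close>, each of measure \<open>m\<close>.\<close>
  have upper: "a (Suc n) \<le> c n * m" for n
  proof -
    let ?P = "h ` set_power H E n"
    have Pc: "?P \<subseteq> carrier L" using H.set_power_closed[OF E(2), of n] by auto
    have Pf: "finite ?P" "card ?P \<le> card (set_power H E n)"
      using H.finite_set_power[OF E(1)] by (auto intro: card_image_le)
    have PV: "compactin T (?P <#>\<^bsub>L\<^esub> V)"
      using Pf(1) Pc
      by (intro L.compactin_set_mult[OF _ K] finite_imp_compactin) (auto simp: L.topspace_eq)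
    have "emeasure \<mu> (?P <#>\<^bsub>L\<^esub> V) \<le> of_nat (card ?P) * emeasure \<mu> V"
      using Pf Pc K
      by (intro L.emeasure_set_mult_le) (auto intro: L.sets_compactin L.compactin_l_coset)
    then have "ennreal (measure \<mu> (?P <#>\<^bsub>L\<^esub> V)) \<le> of_nat (card ?P) * ennreal m"
      using fin[OF K] fin[OF PV] by (simp add: m_def emeasure_eq_ennreal_measure)
    also have "\<dots> = ennreal (real (card ?P) * m)"
      using m by (simp add: ennreal_mult ennreal_of_nat_eq_real_of_nat)
    finally have "measure \<mu> (?P <#>\<^bsub>L\<^esub> V) \<le> real (card ?P) * m"
      using m by (simp add: ennreal_le_iff)
    also have "\<dots> \<le> c n * m" using Pf(2) m by (simp add: c_def)
    moreover have "a (Suc n) \<le> measure \<mu> (?P <#>\<^bsub>L\<^esub> V)"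
      unfolding a_def
      by (intro meas_mono set_power_Suc_subset E(2) Vc VV PV L.compactin_set_power K)
    ultimately show ?thesis by linarith
  qed
  have c_mono: "c n \<le> c (Suc n)" for n
    unfolding c_def
    using H.set_power_Suc_mono[OF E(2,3), of n] H.finite_set_power[OF E(1), of "Suc n"]
    by (simp add: card_mono)
  \<comment> \<open>Monotonicity of \<open>c\<close> absorbs the index shift, so that both sides can
    be compared under the same root.\<close>
  have upper': "a n \<le> m * c n" if "n > 0" for n
  proof -
    have "a n \<le> c (n - 1) * m" using upper[of "n - 1"] that by simp
    also have "\<dots> \<le> c n * m"
      using c_mono[of "n - 1"] that m by (intro mult_right_mono) auto
    finally show ?thesis by (simp add: mult.commute)
  qed
  have lower: "m \<le> a n" if "n > 0" for n
    unfolding a_def m_def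
    using that by (intro meas_mono L.subset_set_power Vc V1 K L.compactin_set_power)
  \<comment> \<open>The roots of a positive constant tend to 1, so the factor \<open>m\<close>
    disappears from both sides of the squeeze.\<close>
  have root_m: "(\<lambda>n. ereal (root n m)) \<longlonglongrightarrow> 1"
    using LIMSEQ_root_const[OF m] by (simp add: one_ereal_def)
  \<comment> \<open>In a discrete space compact means finite and every subset is open, so the growth
    hypothesis applies to \<open>E\<close>.\<close>
  have "compact_nhd_one H (discrete_topology (carrier H)) E"
    using E by (auto simp: compact_nhd_one_def compactin_discrete_topology)
  then have "limsup (\<lambda>n. ereal (root n (measure (count_space (carrier H)) (set_power H E n)))) = 1"
    using H haar_measure_count_space[OF \<open>group H\<close>]
    by (simp add: subexponential_growth_def)
  moreover have "measure (count_space (carrier H)) (set_power H E n) = c n" for n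
    using H.set_power_closed[OF E(2)] H.finite_set_power[OF E(1)]
    by (simp add: measure_def emeasure_count_space c_def)
  ultimately have c_lim: "limsup (\<lambda>n. ereal (root n (c n))) = 1" by simp
  have "limsup (\<lambda>n. ereal (root n (a n))) \<le> limsup (\<lambda>n. ereal (root n m) * ereal (root n (c n)))"
  proof (rule Limsup_mono)
    show "\<forall>\<^sub>F n in sequentially. ereal (root n (a n)) \<le> ereal (root n m) * ereal (root n (c n))"
      using eventually_gt_at_top[of 0]
    proof eventually_elim
      case (elim n)
      then show ?case
        using real_root_le_mono[OF elim upper'[OF elim]] by (simp add: real_root_mult)
    qed
  qed
  \<comment> \<open>The limit superior is multiplicative when one factor converges to a finite
    nonzero limit.\<close>
  also have "\<dots> = 1"
    using ereal_limsup_lim_mult[OF root_m, of "\<lambda>n. ereal (root n (c n))"] c_lim by simp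
  finally have "limsup (\<lambda>n. ereal (root n (a n))) \<le> 1" .
  moreover have "1 \<le> limsup (\<lambda>n. ereal (root n (a n)))"
  proof -
    have "limsup (\<lambda>n. ereal (root n m)) \<le> limsup (\<lambda>n. ereal (root n (a n)))"
      using eventually_gt_at_top[of 0]
      by (intro Limsup_mono, eventually_elim) (simp add: real_root_le_mono lower)
    then show ?thesis using lim_imp_Limsup[OF _ root_m] by simp
  qed
  ultimately show "limsup (\<lambda>n. ereal (root n (measure \<mu> (set_power L V n)))) = 1"
    unfolding a_def by (rule antisym)
qed

section \<open>Permutation groups\<close>

lemma continuous_map_discrete_topologyI:
  assumes "f ` topspace X \<subseteq> S"
    and "\<And>x. x \<in> topspace X \<Longrightarrow> \<exists>W. openin X W \<and> x \<in> W \<and> (\<forall>y\<in>W. f y = f x)"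
  shows "continuous_map X (discrete_topology S) f"
  unfolding continuous_map_def
proof (intro conjI allI impI)
  show "f \<in> topspace X \<rightarrow> topspace (discrete_topology S)" using assms(1) by auto
  fix U
  show "openin X {x \<in> topspace X. f x \<in> U}"
  proof (subst openin_subopen, intro ballI)
    fix x assume x: "x \<in> {x \<in> topspace X. f x \<in> U}"
    then obtain W where W: "openin X W" "x \<in> W" "\<forall>y\<in>W. f y = f x" using assms(2)[of x] by auto
    have "W \<subseteq> {x \<in> topspace X. f x \<in> U}"
    proof
      fix y assume "y \<in> W"
      with W(3) have "f y = f x" by (rule bspec)
      with x openin_subset[OF W(1)] \<open>y \<in> W\<close> show "y \<in> {x \<in> topspace X. f x \<in> U}" by auto
    qed
    with W show "\<exists>W. openin X W \<and> x \<in> W \<and> W \<subseteq> {x \<in> topspace X. f x \<in> U}" by iprover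
  qed
qed

lemma topspace_permutation_topology [simp]: "topspace (permutation_topology S) = Bij S"
  by (auto simp: permutation_topology_def Bij_def PiE_def bij_betw_def)

lemma Hausdorff_space_permutation_topology: "Hausdorff_space (permutation_topology S)"
  by (simp add: permutation_topology_def Hausdorff_space_subtopology Hausdorff_space_product_topology)

lemma openin_product_discrete:
  assumes "s \<in> S"
  shows "openin (product_topology (\<lambda>_. discrete_topology S) S) {f \<in> S \<rightarrow>\<^sub>E S. f s = t}"
proof -
  have "continuous_map (product_topology (\<lambda>_. discrete_topology S) S) (discrete_topology S) (\<lambda>f. f s)"
    using assms by (rule continuous_map_product_projection)
  from openin_continuous_map_preimage[OF this, of "{t} \<inter> S"]
  have "openin (product_topology (\<lambda>_. discrete_topology S) S) {f \<in> S \<rightarrow>\<^sub>E S. f s \<in> {t} \<inter> S}"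
    by simp
  moreover have "{f \<in> S \<rightarrow>\<^sub>E S. f s \<in> {t} \<inter> S} = {f \<in> S \<rightarrow>\<^sub>E S. f s = t}"
    using assms by auto
  ultimately show ?thesis by simp
qed

lemma openin_permutation_topology:
  assumes "s \<in> S"
  shows "openin (permutation_topology S) {f \<in> Bij S. f s = t}"
proof -
  have "{f \<in> Bij S. f s = t} = {f \<in> S \<rightarrow>\<^sub>E S. f s = t} \<inter> Bij S"
    by (auto simp: Bij_def PiE_def bij_betw_def)
  with openin_product_discrete[OF assms] show ?thesis
    unfolding permutation_topology_def by (auto simp: openin_subtopology)
qed

text \<open>Continuity is checked one evaluation at a time, and a map into a discrete space is
  continuous once it is locally constant.\<close>

lemma continuous_map_permutation_topologyI:
  assumes "f ` topspace X \<subseteq> Bij S"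
    and "\<And>x s. x \<in> topspace X \<Longrightarrow> s \<in> S \<Longrightarrow> \<exists>W. openin X W \<and> x \<in> W \<and> (\<forall>y\<in>W. f y s = f x s)"
  shows "continuous_map X (permutation_topology S) f"
  unfolding permutation_topology_def continuous_map_in_subtopology continuous_map_componentwise
proof (intro conjI ballI)
  show "f ` topspace X \<subseteq> extensional S" "f \<in> topspace X \<rightarrow> Bij S"
    using assms(1) by (auto simp: Bij_def)
  fix s assume "s \<in> S"
  have "f x s \<in> S" if "x \<in> topspace X" for x
  proof -
    have "f x \<in> Bij S" using assms(1) that by blast
    with \<open>s \<in> S\<close> show ?thesis by (auto simp: Bij_def bij_betw_def)
  qed
  with assms(2) \<open>s \<in> S\<close> show "continuous_map X (discrete_topology S) (\<lambda>x. f x s)"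
    by (intro continuous_map_discrete_topologyI) auto
qed

text \<open>Finitely many values decide everything: the product of \<open>g\<close> and
  \<open>f\<close> at \<open>s\<close> depends only on \<open>f s\<close> and on \<open>g\<close> at
  the point \<open>f s\<close>, and the inverse of \<open>f\<close> takes the value \<open>t\<close>
  at \<open>s\<close> as soon as \<open>f t = s\<close>.\<close>

lemma topological_group_BijGroup: "topological_group (BijGroup S) (permutation_topology S)"
proof -
  interpret group "BijGroup S" by (rule group_BijGroup)
  let ?P = "permutation_topology S"
  have c: "carrier (BijGroup S) = Bij S" by (simp add: BijGroup_def)
  have m: "g \<otimes>\<^bsub>BijGroup S\<^esub> f = compose S g f" if "g \<in> Bij S" "f \<in> Bij S" for f g
    using that by (simp add: BijGroup_def)
  have Bij_closed: "f s \<in> S" if "f \<in> Bij S" "s \<in> S" for f s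
    using that by (auto simp: Bij_def bij_betw_def)
  show ?thesis
  proof
    show "topspace ?P = carrier (BijGroup S)" by (simp add: c)
    show "continuous_map (prod_topology ?P ?P) ?P (\<lambda>(x, y). x \<otimes>\<^bsub>BijGroup S\<^esub> y)"
    proof (rule continuous_map_permutation_topologyI)
      show "(\<lambda>(x, y). x \<otimes>\<^bsub>BijGroup S\<^esub> y) ` topspace (prod_topology ?P ?P) \<subseteq> Bij S"
        using m_closed by (auto simp: c)
      fix z s assume z: "z \<in> topspace (prod_topology ?P ?P)" and s: "s \<in> S"
      obtain g f where gf: "z = (g, f)" "g \<in> Bij S" "f \<in> Bij S" using z by auto
      let ?W = "{g' \<in> Bij S. g' (f s) = g (f s)} \<times> {f' \<in> Bij S. f' s = f s}"
      have "openin (prod_topology ?P ?P) ?W"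
        using gf s Bij_closed
        by (intro openin_prod_Times_iff[THEN iffD2] disjI2 conjI openin_permutation_topology) auto
      moreover have "z \<in> ?W" using gf by simp
      moreover have "(case y of (x, y) \<Rightarrow> x \<otimes>\<^bsub>BijGroup S\<^esub> y) s = (case z of (x, y) \<Rightarrow> x \<otimes>\<^bsub>BijGroup S\<^esub> y) s"
        if "y \<in> ?W" for y
        using that gf s by (auto simp: m compose_def)
      ultimately show "\<exists>W. openin (prod_topology ?P ?P) W \<and> z \<in> W \<and>
          (\<forall>y\<in>W. (case y of (x, y) \<Rightarrow> x \<otimes>\<^bsub>BijGroup S\<^esub> y) s = (case z of (x, y) \<Rightarrow> x \<otimes>\<^bsub>BijGroup S\<^esub> y) s)"
        by blast
    qed
    show "continuous_map ?P ?P (\<lambda>x. inv\<^bsub>BijGroup S\<^esub> x)"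
    proof (rule continuous_map_permutation_topologyI)
      show "(\<lambda>x. inv\<^bsub>BijGroup S\<^esub> x) ` topspace ?P \<subseteq> Bij S"
        using inv_closed by (auto simp: c)
      fix f s assume "f \<in> topspace ?P" and s: "s \<in> S"
      then have f: "f \<in> Bij S" by simp
      have "s \<in> f ` S" using f s by (simp add: Bij_def bij_betw_def)
      then obtain t where t: "t \<in> S" "f t = s" by auto
      have "(inv\<^bsub>BijGroup S\<^esub> g) s = t" if "g \<in> Bij S" "g t = s" for g
        using that t s by (auto simp: inv_BijGroup Bij_def bij_betw_def inv_into_f_f)
      then have "openin ?P {g \<in> Bij S. g t = s}" "f \<in> {g \<in> Bij S. g t = s}"
        "\<forall>g\<in>{g \<in> Bij S. g t = s}. (inv\<^bsub>BijGroup S\<^esub> g) s = (inv\<^bsub>BijGroup S\<^esub> f) s"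
        using f t by (auto intro: openin_permutation_topology)
      then show "\<exists>W. openin ?P W \<and> f \<in> W \<and>
          (\<forall>g\<in>W. (inv\<^bsub>BijGroup S\<^esub> g) s = (inv\<^bsub>BijGroup S\<^esub> f) s)"
        by blast
    qed
  qed
qed

text \<open>The closure of \<open>A\<close> in the full product space consists of injections preserving the finite
  orbits of \<open>A\<close>, hence of permutations; being closed in a product of finite sets, it is compact.\<close>

lemma compactin_closure_of_finite_orbits:
  assumes A: "subgroup A (BijGroup S)" and fin: "\<And>s. s \<in> S \<Longrightarrow> finite ((\<lambda>f. f s) ` A)"
  shows "compactin (permutation_topology S) (permutation_topology S closure_of A)"
proof -
  interpret A: subgroup A "BijGroup S" by (rule A)
  let ?X = "product_topology (\<lambda>_. discrete_topology S) S"
  define orb where "orb s = (\<lambda>f. f s) ` A" for s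
  have AB: "A \<subseteq> Bij S" using A.subset by (simp add: BijGroup_def)
  have BijS: "f s \<in> S" if "f \<in> Bij S" "s \<in> S" for f s
    using that by (auto simp: Bij_def bij_betw_def)
  have orb_S: "orb s \<subseteq> S" if "s \<in> S" for s
    using that AB BijS by (auto simp: orb_def)
  have orb_fin: "finite (orb s)" if "s \<in> S" for s
    using fin[OF that] by (simp add: orb_def)
  have orb_self: "s \<in> orb s" if "s \<in> S" for s
  proof -
    have "(\<lambda>x\<in>S. x) \<in> A" using A.one_closed by (simp add: BijGroup_def)
    with that show ?thesis unfolding orb_def by (intro image_eqI[of _ _ "\<lambda>x\<in>S. x"]) auto
  qed
  have orb_closed: "f t \<in> orb s" if s: "s \<in> S" and t: "t \<in> orb s" and f: "f \<in> A" for f s t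
  proof -
    obtain g where g: "g \<in> A" "t = g s" using t unfolding orb_def by blast
    have "compose S f g \<in> A"
      using A.m_closed[OF f g(1)] AB f g(1) by (auto simp: BijGroup_def subset_iff)
    with g s show ?thesis
      unfolding orb_def by (intro image_eqI[of _ _ "compose S f g"]) (auto simp: compose_def)
  qed
  let ?C = "?X closure_of A"
  have K: "compactin ?X (PiE S orb)"
    using orb_S orb_fin by (auto simp: compactin_PiE compactin_discrete_topology)
  have "closedin ?X (PiE S orb)"
    by (intro compactin_imp_closedin K) (simp add: Hausdorff_space_product_topology)
  moreover have "A \<subseteq> PiE S orb"
    using AB orb_self orb_closed by (auto simp: Bij_def PiE_def)
  ultimately have CK: "?C \<subseteq> PiE S orb" by (intro closure_of_minimal)
  \<comment> \<open>A pointwise limit of \<open>A\<close> agrees with some member of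
    \<open>A\<close> on any given finite set. Two points are enough for injectivity, one for
    invariance of the orbits.\<close>
  have approx: "\<exists>g\<in>A. \<forall>s\<in>F. g s = f s" if f: "f \<in> ?C" and F: "F \<subseteq> S" "finite F" for f F
  proof -
    have fX: "f \<in> S \<rightarrow>\<^sub>E S" using f closure_of_subset_topspace[of ?X A] by auto
    have "openin ?X {g \<in> topspace ?X. \<forall>s\<in>F. g s = f s}"
    proof -
      have "{g \<in> topspace ?X. \<forall>s\<in>F. g s = f s} = topspace ?X \<inter> (\<Inter>s\<in>F. {g \<in> S \<rightarrow>\<^sub>E S. g s = f s})"
        by auto
      also have "openin ?X \<dots>"
        using F by (intro openin_Int_Inter openin_topspace) (auto intro: openin_product_discrete)
      finally show ?thesis .
    qed
    moreover have "f \<in> {g \<in> topspace ?X. \<forall>s\<in>F. g s = f s}" using fX by simp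
    moreover have "\<forall>W. f \<in> W \<and> openin ?X W \<longrightarrow> (\<exists>g. g \<in> A \<and> g \<in> W)"
      using f unfolding in_closure_of by (rule conjunct2)
    ultimately have "\<exists>g. g \<in> A \<and> g \<in> {g \<in> topspace ?X. \<forall>s\<in>F. g s = f s}"
      by meson
    then show ?thesis by auto
  qed
  have "?C \<subseteq> Bij S"
  proof
    fix f assume f: "f \<in> ?C"
    then have fO: "f \<in> PiE S orb" using CK by auto
    then have fS: "f s \<in> S" if "s \<in> S" for s using that orb_S[OF that] by auto
    have inj: "inj_on f S"
    proof (rule inj_onI)
      fix s t assume st: "s \<in> S" "t \<in> S" "f s = f t"
      obtain g where g: "g \<in> A" "\<forall>x\<in>{s, t}. g x = f x" using approx[OF f, of "{s, t}"] st by auto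
      then have "g s = g t" using st by simp
      with g(1) AB st show "s = t" by (auto simp: Bij_def bij_betw_def inj_on_def subset_iff)
    qed
    have "t \<in> f ` S" if t: "t \<in> S" for t
    proof -
      have "f x \<in> orb t" if x: "x \<in> orb t" for x
      proof -
        have "x \<in> S" using orb_S[OF t] x by auto
        then obtain g where "g \<in> A" "g x = f x" using approx[OF f, of "{x}"] by auto
        with orb_closed[OF t x] show ?thesis by metis
      qed
      \<comment> \<open>An injective map of a finite orbit into itself is onto, so \<open>t\<close>
        is already attained on \<open>orb t\<close>.\<close>
      then have "f ` orb t = orb t"
        using orb_S[OF t] inj by (intro endo_inj_surj orb_fin t) (auto intro: inj_on_subset)
      with orb_self[OF t] orb_S[OF t] show ?thesis by blast
    qed
    with inj fS have "bij_betw f S S" by (auto simp: bij_betw_def)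
    moreover have "f \<in> extensional S" using fO by (simp add: PiE_def)
    ultimately show "f \<in> Bij S" by (simp add: Bij_def)
  qed
  moreover have "compactin ?X ?C"
    by (rule closed_compactin[OF K CK]) simp
  \<comment> \<open>The closure in the subspace is the trace of the closure in the product, and that
    closure already lies in \<open>Bij S\<close>.\<close>
  moreover have "permutation_topology S closure_of A = ?C"
    using \<open>?C \<subseteq> Bij S\<close> AB
    by (auto simp: permutation_topology_def closure_of_subtopology Int_absorb1)
  ultimately show ?thesis
    by (simp add: permutation_topology_def compactin_subtopology)
qed

text \<open>The stabilizer of \<open>s\<close> in the closure \<open>C\<close> is open, being given
  by one evaluation. It lies in the closure of the stabilizer of \<open>s\<close> in
  \<open>D\<close>, which is compact because that stabilizer has finite orbits. This is a compact
  neighbourhood of the identity.\<close>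

lemma locally_compact_group_closure_of_permutations:
  assumes D: "subgroup D (BijGroup S)" and s: "s \<in> S"
    and fin: "\<And>t. t \<in> S \<Longrightarrow> finite ((\<lambda>f. f t) ` {f \<in> D. f s = s})"
  defines "C \<equiv> permutation_topology S closure_of D"
  shows "locally_compact_group ((BijGroup S)\<lparr>carrier := C\<rparr>) (subtopology (permutation_topology S) C)"
proof -
  let ?P = "permutation_topology S"
  interpret P: topological_group "BijGroup S" ?P by (rule topological_group_BijGroup)
  interpret D: subgroup D "BijGroup S" by (rule D)
  have C: "subgroup C (BijGroup S)" unfolding C_def by (rule P.subgroup_closure_of[OF D])
  interpret C: topological_group "(BijGroup S)\<lparr>carrier := C\<rparr>" "subtopology ?P C"
    by (rule P.topological_group_subgroup[OF C])
  have c: "carrier (BijGroup S) = Bij S" by (simp add: BijGroup_def)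
  have CB: "C \<subseteq> Bij S" using subgroup.subset[OF C] c by simp
  have DB: "D \<subseteq> Bij S" using D.subset c by simp
  have one: "\<one>\<^bsub>BijGroup S\<^esub> s = s" using s by (simp add: BijGroup_def)
  define A where "A = {f \<in> D. f s = s}"
  have A: "subgroup A (BijGroup S)"
  proof (rule P.subgroupI)
    show "A \<subseteq> carrier (BijGroup S)" using D.subset by (auto simp: A_def)
    show "A \<noteq> {}" using one D.one_closed unfolding A_def by blast
    show "inv\<^bsub>BijGroup S\<^esub> f \<in> A" if "f \<in> A" for f
    proof -
      have f: "f \<in> D" "f s = s" "f \<in> Bij S" using that DB by (auto simp: A_def)
      then have "(inv\<^bsub>BijGroup S\<^esub> f) s = s"
        using s by (auto simp: inv_BijGroup Bij_def bij_betw_def intro: inv_into_f_eq)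
      with D.m_inv_closed[OF f(1)] show ?thesis by (simp add: A_def)
    qed
    show "f \<otimes>\<^bsub>BijGroup S\<^esub> g \<in> A" if "f \<in> A" "g \<in> A" for f g
      using that s DB D.m_closed[of f g]
      by (auto simp: A_def BijGroup_def subset_iff compose_def)
  qed
  have K: "compactin ?P (?P closure_of A)"
    using fin by (intro compactin_closure_of_finite_orbits[OF A]) (simp add: A_def)
  have KC: "?P closure_of A \<subseteq> C" unfolding C_def by (rule closure_of_mono) (auto simp: A_def)
  let ?U = "{f \<in> C. f s = s}"
  have oB: "openin ?P {f \<in> Bij S. f s = s}" by (rule openin_permutation_topology[OF s])
  have "openin (subtopology ?P C) ?U"
  proof -
    have "?U = {f \<in> Bij S. f s = s} \<inter> C" using CB by auto
    with oB show ?thesis by (auto simp: openin_subtopology)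
  qed
  moreover have "compactin (subtopology ?P C) (?P closure_of A)"
    using K KC by (simp add: compactin_subtopology)
  moreover have "\<one>\<^bsub>(BijGroup S)\<lparr>carrier := C\<rparr>\<^esub> \<in> ?U"
    using one subgroup.one_closed[OF C] by simp
  moreover have "?U \<subseteq> ?P closure_of A"
  proof -
    \<comment> \<open>For an open set \<open>W\<close>, the part of the closure of \<open>D\<close>
      in \<open>W\<close> lies in the closure of \<open>W \<inter> D\<close>; here
      \<open>W \<inter> D\<close> is the stabilizer \<open>A\<close>.\<close>
    have "{f \<in> Bij S. f s = s} \<inter> C \<subseteq> ?P closure_of ({f \<in> Bij S. f s = s} \<inter> D)"
      unfolding C_def by (rule openin_Int_closure_of_subset[OF oB])
    moreover have "{f \<in> Bij S. f s = s} \<inter> D = A" using DB by (auto simp: A_def)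
    ultimately show ?thesis using CB by auto
  qed
  ultimately have "locally_compact_space (subtopology ?P C)"
    by (rule C.locally_compact_space_if_compact_nhd)
  with C.topological_group_axioms show ?thesis
    unfolding locally_compact_group_iff
    by (simp add: Hausdorff_space_subtopology Hausdorff_space_permutation_topology)
qed

section \<open>The Schlichting completion\<close>

context group
begin

section \<open>The action on left cosets and its kernel\<close>

lemma l_coset_in_lcosets:
  assumes "subgroup \<Gamma> G" "g \<in> carrier G" "X \<in> lcosets \<Gamma>"
  shows "g <# X \<in> lcosets \<Gamma>"
proof -
  obtain x where x: "x \<in> carrier G" "X = x <# \<Gamma>" using assms(3) by (auto simp: LCOSETS_def)
  with assms have "g <# X = (g \<otimes> x) <# \<Gamma>" by (simp add: lcos_m_assoc subgroup.subset)
  with x assms(2) show ?thesis by (auto simp: LCOSETS_def)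
qed

lemma coset_action_hom:
  assumes \<Gamma>: "subgroup \<Gamma> G"
  shows "coset_action G \<Gamma> \<in> hom G (BijGroup (lcosets \<Gamma>))"
proof -
  have sub: "X \<subseteq> carrier G" if "X \<in> lcosets \<Gamma>" for X
    using subgroup.lcosets_carrier[OF \<Gamma> is_group that] .
  have mult: "g <# (h <# X) = (g \<otimes> h) <# X"
    if "g \<in> carrier G" "h \<in> carrier G" "X \<in> lcosets \<Gamma>" for g h X
    using that sub by (simp add: lcos_m_assoc)
  have one: "\<one> <# X = X" if "X \<in> lcosets \<Gamma>" for X
    using that sub by (simp add: lcos_mult_one)
  have Bij: "coset_action G \<Gamma> g \<in> Bij (lcosets \<Gamma>)" if g: "g \<in> carrier G" for g
  proof -
    have "bij_betw (\<lambda>X. g <# X) (lcosets \<Gamma>) (lcosets \<Gamma>)"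
      using g by (intro bij_betwI[where g = "\<lambda>X. inv g <# X"])
        (auto simp: mult one l_coset_in_lcosets[OF \<Gamma>])
    then have "bij_betw (coset_action G \<Gamma> g) (lcosets \<Gamma>) (lcosets \<Gamma>)"
      by (rule bij_betw_cong[THEN iffD1, rotated]) (simp add: coset_action_def)
    then show ?thesis by (simp add: Bij_def coset_action_def)
  qed
  show ?thesis
  proof (rule homI)
    fix g h assume gh: "g \<in> carrier G" "h \<in> carrier G"
    show "coset_action G \<Gamma> (g \<otimes> h) =
        coset_action G \<Gamma> g \<otimes>\<^bsub>BijGroup (lcosets \<Gamma>)\<^esub> coset_action G \<Gamma> h"
      using gh Bij by (auto simp: BijGroup_def compose_def coset_action_def fun_eq_iff mult
          l_coset_in_lcosets[OF \<Gamma>])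
  qed (use Bij in \<open>simp add: BijGroup_def\<close>)
qed

text \<open>An element fixes the coset of \<open>x\<close> exactly when it lies in the conjugate of
  \<open>\<Gamma>\<close> by \<open>x\<close>; intersecting over all \<open>x\<close> gives the
  core. This is what lets the action descend to the reduced group.\<close>

lemma kernel_coset_action:
  assumes \<Gamma>: "subgroup \<Gamma> G"
  shows "kernel G (BijGroup (lcosets \<Gamma>)) (coset_action G \<Gamma>) = hecke_core G \<Gamma>"
proof -
  interpret \<Gamma>: subgroup \<Gamma> G by (rule \<Gamma>)
  have fix_iff: "g <# (x <# \<Gamma>) = x <# \<Gamma> \<longleftrightarrow> g \<in> (x <# \<Gamma>) #> inv x"
    if g: "g \<in> carrier G" and x: "x \<in> carrier G" for g x
  proof -
    have "g <# (x <# \<Gamma>) = x <# \<Gamma> \<longleftrightarrow> (g \<otimes> x) <# \<Gamma> = x <# \<Gamma>"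
      using g x by (simp add: lcos_m_assoc \<Gamma>.subset)
    also have "\<dots> \<longleftrightarrow> g \<otimes> x \<in> x <# \<Gamma>"
      using g x lcos_self[of "g \<otimes> x" \<Gamma>] l_repr_independence[of "g \<otimes> x" x \<Gamma>] \<Gamma> by auto
    also have "\<dots> \<longleftrightarrow> g \<in> (x <# \<Gamma>) #> inv x"
    proof
      assume "g \<otimes> x \<in> x <# \<Gamma>"
      moreover have "g = (g \<otimes> x) \<otimes> inv x" using g x by (simp add: m_assoc)
      ultimately show "g \<in> (x <# \<Gamma>) #> inv x" by (auto simp: r_coset_def)
    next
      assume "g \<in> (x <# \<Gamma>) #> inv x"
      then obtain h where "h \<in> x <# \<Gamma>" "g = h \<otimes> inv x" by (auto simp: r_coset_def)
      moreover from this have "h \<in> carrier G" using x \<Gamma>.subset by (auto simp: l_coset_def)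
      ultimately show "g \<otimes> x \<in> x <# \<Gamma>" using x by (simp add: m_assoc)
    qed
    finally show ?thesis .
  qed
  have core: "hecke_core G \<Gamma> \<subseteq> carrier G"
  proof -
    have "hecke_core G \<Gamma> \<subseteq> (\<one> <# \<Gamma>) #> inv \<one>" unfolding hecke_core_def by blast
    then show ?thesis using \<Gamma>.subset by (auto simp: r_coset_def l_coset_def)
  qed
  have "coset_action G \<Gamma> g = \<one>\<^bsub>BijGroup (lcosets \<Gamma>)\<^esub> \<longleftrightarrow> (\<forall>X\<in>lcosets \<Gamma>. g <# X = X)" for g
    by (auto simp: BijGroup_def coset_action_def fun_eq_iff restrict_def)
  then have "g \<in> kernel G (BijGroup (lcosets \<Gamma>)) (coset_action G \<Gamma>) \<longleftrightarrow> g \<in> hecke_core G \<Gamma>"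
    if "g \<in> carrier G" for g
    using that fix_iff by (simp add: kernel_def hecke_core_def LCOSETS_def)
  with core show ?thesis by (auto simp: kernel_def)
qed

end

text \<open>Moving the coset of \<open>x\<close> by an element of \<open>\<Gamma>\<close> stays
  inside the double coset of \<open>x\<close>, which is a finite union of left cosets. Left cosets
  that meet are equal, so the orbit is among these finitely many.\<close>

lemma hecke_pair_finite_orbits:
  assumes "hecke_pair G \<Gamma>" and X: "X \<in> lcosets\<^bsub>G\<^esub> \<Gamma>"
  shows "finite ((\<lambda>g. g <#\<^bsub>G\<^esub> X) ` \<Gamma>)"
proof -
  interpret group G using assms(1) by (simp add: hecke_pair_def)
  have \<Gamma>: "subgroup \<Gamma> G" using assms(1) by (simp add: hecke_pair_def)
  interpret \<Gamma>: subgroup \<Gamma> G by (rule \<Gamma>)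
  obtain x where x: "x \<in> carrier G" "X = x <#\<^bsub>G\<^esub> \<Gamma>" using X by (auto simp: LCOSETS_def)
  obtain F where F: "finite F" "F \<subseteq> carrier G"
      "(\<Gamma> #>\<^bsub>G\<^esub> x) <#>\<^bsub>G\<^esub> \<Gamma> = (\<Union>y\<in>F. y <#\<^bsub>G\<^esub> \<Gamma>)"
    using assms(1) x(1) unfolding hecke_pair_def by meson
  have "g <#\<^bsub>G\<^esub> X \<in> (\<lambda>y. y <#\<^bsub>G\<^esub> \<Gamma>) ` F" if g: "g \<in> \<Gamma>" for g
  proof -
    have gc: "g \<in> carrier G" using g by simp
    have eq: "g <#\<^bsub>G\<^esub> X = (g \<otimes>\<^bsub>G\<^esub> x) <#\<^bsub>G\<^esub> \<Gamma>"
      using gc x by (simp add: lcos_m_assoc \<Gamma>.subset)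
    have "(g \<otimes>\<^bsub>G\<^esub> x) \<otimes>\<^bsub>G\<^esub> \<one>\<^bsub>G\<^esub> \<in> (\<Gamma> #>\<^bsub>G\<^esub> x) <#>\<^bsub>G\<^esub> \<Gamma>"
      using g \<Gamma>.one_closed unfolding set_mult_def r_coset_def by blast
    then have "g \<otimes>\<^bsub>G\<^esub> x \<in> (\<Union>y\<in>F. y <#\<^bsub>G\<^esub> \<Gamma>)"
      using gc x(1) F(3) by simp
    then obtain y where y: "y \<in> F" "g \<otimes>\<^bsub>G\<^esub> x \<in> y <#\<^bsub>G\<^esub> \<Gamma>" by blast
    then have "y <#\<^bsub>G\<^esub> \<Gamma> = (g \<otimes>\<^bsub>G\<^esub> x) <#\<^bsub>G\<^esub> \<Gamma>"
      using F(2) by (intro l_repr_independence \<Gamma>) auto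
    with y(1) eq show ?thesis by auto
  qed
  then have "(\<lambda>g. g <#\<^bsub>G\<^esub> X) ` \<Gamma> \<subseteq> (\<lambda>y. y <#\<^bsub>G\<^esub> \<Gamma>) ` F" by blast
  with F(1) show ?thesis by (meson finite_imageI finite_subset)
qed

theorem corollary1:
  fixes G :: "('a, 'b) monoid_scheme" and \<Gamma> :: "'a set"
  assumes "hecke_pair G \<Gamma>"
    and "subexponential_growth G (discrete_topology (carrier G)) \<or>
         subexponential_growth (reduced_group G \<Gamma>)
           (discrete_topology (carrier (reduced_group G \<Gamma>)))"
  shows "subexponential_growth (schlichting_group G \<Gamma>) (schlichting_topology G \<Gamma>)"
proof -
  interpret group G using assms(1) by (simp add: hecke_pair_def)
  have \<Gamma>: "subgroup \<Gamma> G" using assms(1) by (simp add: hecke_pair_def)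
  interpret \<Gamma>: subgroup \<Gamma> G by (rule \<Gamma>)
  let ?S = "lcosets\<^bsub>G\<^esub> \<Gamma>" and ?\<pi> = "coset_action G \<Gamma>"
  let ?P = "permutation_topology ?S" and ?L = "schlichting_group G \<Gamma>"
    and ?T = "schlichting_topology G \<Gamma>"
  let ?D = "?\<pi> ` carrier G"
  interpret \<pi>: group_hom G "BijGroup ?S" ?\<pi>
    by (simp add: group_hom_def group_hom_axioms_def coset_action_hom[OF \<Gamma>] group_BijGroup)
  have D: "subgroup ?D (BijGroup ?S)" by (rule \<pi>.img_is_subgroup)
  have carr: "carrier ?L = ?P closure_of ?D"
    by (simp add: schlichting_group_def schlichting_carrier_def)
  have DL: "?D \<subseteq> carrier ?L"
    unfolding carr using subgroup.subset[OF D] by (intro closure_of_subset) (simp add: BijGroup_def)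
  \<comment> \<open>The trivial coset is the base point; its stabilizer in the image of
    \<open>G\<close> is the image of \<open>\<Gamma>\<close>.\<close>
  have \<Gamma>S: "\<Gamma> \<in> ?S"
    using lcos_mult_one[OF \<Gamma>.subset] by (auto simp: LCOSETS_def)
  have lc: "locally_compact_group ?L ?T"
    unfolding schlichting_group_def schlichting_topology_def schlichting_carrier_def
  proof (rule locally_compact_group_closure_of_permutations[OF D \<Gamma>S])
    fix X assume X: "X \<in> ?S"
    \<comment> \<open>If \<open>g\<close> fixes the trivial coset, then \<open>g\<close> lies in its
      own coset, which is \<open>\<Gamma>\<close>. So the orbits of the stabilizer are contained in
      \<open>\<Gamma>\<close>-orbits.\<close>
    have "g \<in> \<Gamma>" if "g \<in> carrier G" "?\<pi> g \<Gamma> = \<Gamma>" for g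
      using that \<Gamma>S lcos_self[OF that(1) \<Gamma>] by (simp add: coset_action_def)
    then have "(\<lambda>f. f X) ` {f \<in> ?D. f \<Gamma> = \<Gamma>} \<subseteq> (\<lambda>g. g <#\<^bsub>G\<^esub> X) ` \<Gamma>"
      using X by (auto simp: coset_action_def)
    with hecke_pair_finite_orbits[OF assms(1) X]
    show "finite ((\<lambda>f. f X) ` {f \<in> ?D. f \<Gamma> = \<Gamma>})" by (rule finite_subset[rotated])
  qed
  interpret L: group ?L using lc by (simp add: locally_compact_group_def)
  \<comment> \<open>The carrier was defined as the closure of the image, and passing to the subspace
    topology on it does not change that closure.\<close>
  have dense: "?T closure_of ?D = carrier ?L"
    using DL
    by (simp add: schlichting_topology_def closure_of_subtopology carr schlichting_carrier_def
        Int_absorb1)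
  have hom: "?\<pi> \<in> hom G ?L"
    using DL coset_action_hom[OF \<Gamma>] by (auto simp: hom_def schlichting_group_def)
  from assms(2) show ?thesis
  proof
    assume "subexponential_growth G (discrete_topology (carrier G))"
    from subexponential_growth_dense_image[OF lc is_group this hom dense] show ?thesis .
  next
    assume growth: "subexponential_growth (reduced_group G \<Gamma>)
           (discrete_topology (carrier (reduced_group G \<Gamma>)))"
    interpret \<pi>L: group_hom G ?L ?\<pi>
      by (simp add: group_hom_def group_hom_axioms_def hom L.is_group is_group)
    \<comment> \<open>The completion has the identity of the full permutation group, so the kernel
      is the same in both.\<close>
    have ker: "kernel G ?L ?\<pi> = hecke_core G \<Gamma>"
      using kernel_coset_action[OF \<Gamma>] by (simp add: kernel_def schlichting_group_def)
    have normal: "hecke_core G \<Gamma> \<lhd> G" using \<pi>L.normal_kernel ker by simp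
    \<comment> \<open>The action factors through the quotient by its kernel; the induced map has the
      same image, hence again a dense one.\<close>
    obtain h where h: "h \<in> hom (G Mod hecke_core G \<Gamma>) ?L"
        "\<And>x. x \<in> carrier G \<Longrightarrow> h (hecke_core G \<Gamma> #>\<^bsub>G\<^esub> x) = ?\<pi> x"
      using \<pi>L.FactGroup_universal_kernel[OF normal] ker by blast
    have "h ` carrier (reduced_group G \<Gamma>) = ?D"
      using h(2) by (force simp: reduced_group_def FactGroup_def RCOSETS_def)
    then show ?thesis
      using subexponential_growth_dense_image[OF lc _ growth, of h] h(1) dense
        normal.factorgroup_is_group[OF normal]
      by (simp add: reduced_group_def)
  qed
qed

end
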